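(* Let $L$ be a lattice with more than one element. The following conditions are equivalent: (b1) There exists a poset $X$ such that $L\cong F_X$ (order isomorphism). (b2) $L$ is a complete distributive lattice, $L$ has the Decomposition Property $DP$, and $L$ satisfies condition $(\mathfrak{M})$. (b3) $L$ is (a complete lattice which is) dual infinitely distributive, and $L$ has $DP$.
   Context: Posets are nonempty. An up-set of a poset $X$ is a subset $U\subseteq X$ (possibly empty) such that $x\in U$, $y\in X$, $x\le y$ imply $y\in U$. For a poset $X$, $\mathcal{F}_X$ is the family of all up-sets of $X$, and $F_X=(\mathcal{F}_X,\supseteq)$ is this family ordered by reverse inclusion ($U\le V$ iff $U\supseteq V$; so the top is $\emptyset$, the bottom is $X$, meets are unions, joins are intersections). For a complete lattice $L$ with top $1_L$, an element $a\in L$ is completely meet-irreducible if $a\neq 1_L$ and, for every family $\{x_i\mid i\in I\}\subseteq L$, $a=\bigwedge_{i\in I}x_i$ implies $a=x_i$ for some $i\in I$. $M(L)$ is the set of all completely meet-irreducible elements of $L$. $L$ has $DP$ if every $a\in L$ can be written as $a=\bigwedge Q$ for some $Q\subseteq M(L)$ (with $\bigwedge\emptyset=1_L$). $L$ satisfies $(\mathfrak{M})$ if for every $q\in M(L)$ and every $C\subseteq M(L)$, $q\ge\bigwedge C$ implies $q\ge p$ for some $p\in C$. A complete lattice $L$ is dual infinitely distributive if $x\vee\bigwedge S=\bigwedge_{s\in S}(x\vee s)$ for all $x\in L$ and $S\subseteq L$. *)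

theory Defs
  imports "HOL-Algebra.Complete_Lattice"
begin

definition poset :: "('a, 'c) gorder_scheme \<Rightarrow> bool" where
  "poset X \<longleftrightarrow> partial_order X \<and> carrier X \<noteq> {}"

definition up_set :: "('a, 'c) gorder_scheme \<Rightarrow> 'a set \<Rightarrow> bool" where
  "up_set X U \<longleftrightarrow> U \<subseteq> carrier X \<and>
     (\<forall>x\<in>U. \<forall>y\<in>carrier X. x \<sqsubseteq>\<^bsub>X\<^esub> y \<longrightarrow> y \<in> U)"

text \<open>The up-sets ordered by \<^emph>\<open>reverse\<close> inclusion: the top is the empty set, the bottom is the
  carrier, meets are unions and joins are intersections.\<close>

definition up_set_lattice :: "('a, 'c) gorder_scheme \<Rightarrow> 'a set gorder" where
  "up_set_lattice X =
     \<lparr>carrier = {U. up_set X U}, eq = (=), le = (\<lambda>U V. V \<subseteq> U)\<rparr>"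

definition order_isomorphic ::
    "('a, 'c) gorder_scheme \<Rightarrow> ('b, 'd) gorder_scheme \<Rightarrow> bool" where
  "order_isomorphic A B \<longleftrightarrow> (\<exists>f. order_emb A B f \<and> bij_betw f (carrier A) (carrier B))"

definition distributive :: "('a, 'c) gorder_scheme \<Rightarrow> bool" where
  "distributive L \<longleftrightarrow> (\<forall>x\<in>carrier L. \<forall>y\<in>carrier L. \<forall>z\<in>carrier L.
     x \<sqinter>\<^bsub>L\<^esub> (y \<squnion>\<^bsub>L\<^esub> z) = (x \<sqinter>\<^bsub>L\<^esub> y) \<squnion>\<^bsub>L\<^esub> (x \<sqinter>\<^bsub>L\<^esub> z))"

text \<open>The remaining notions are meant for complete lattices only: elsewhere \<open>\<Sqinter>\<close> and \<open>\<top>\<close> may be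
  unspecified. The infimum of a family depends only on its set of members, so
  families are rendered as subsets of the carrier.\<close>

definition completely_meet_irreducible :: "('a, 'c) gorder_scheme \<Rightarrow> 'a \<Rightarrow> bool" where
  "completely_meet_irreducible L a \<longleftrightarrow> a \<in> carrier L \<and> a \<noteq> \<top>\<^bsub>L\<^esub> \<and>
     (\<forall>S\<subseteq>carrier L. a = \<Sqinter>\<^bsub>L\<^esub>S \<longrightarrow> (\<exists>x\<in>S. a = x))"

definition cmi_set :: "('a, 'c) gorder_scheme \<Rightarrow> 'a set" where
  "cmi_set L = {a. completely_meet_irreducible L a}"

definition decomposition_property :: "('a, 'c) gorder_scheme \<Rightarrow> bool" where
  "decomposition_property L \<longleftrightarrow> (\<forall>a\<in>carrier L. \<exists>Q\<subseteq>cmi_set L. a = \<Sqinter>\<^bsub>L\<^esub>Q)"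

definition condition_M :: "('a, 'c) gorder_scheme \<Rightarrow> bool" where
  "condition_M L \<longleftrightarrow> (\<forall>q\<in>cmi_set L. \<forall>C\<subseteq>cmi_set L.
     \<Sqinter>\<^bsub>L\<^esub>C \<sqsubseteq>\<^bsub>L\<^esub> q \<longrightarrow> (\<exists>p\<in>C. p \<sqsubseteq>\<^bsub>L\<^esub> q))"

definition dual_infinitely_distributive :: "('a, 'c) gorder_scheme \<Rightarrow> bool" where
  "dual_infinitely_distributive L \<longleftrightarrow> (\<forall>x\<in>carrier L. \<forall>S\<subseteq>carrier L.
     x \<squnion>\<^bsub>L\<^esub> \<Sqinter>\<^bsub>L\<^esub>S = \<Sqinter>\<^bsub>L\<^esub>((\<lambda>s. x \<squnion>\<^bsub>L\<^esub> s) ` S))"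

end

theory Submission
  imports Defs
begin

text \<open>
  All implications come from two facts.

  First, an isomorphism \<open>f\<close> from \<open>L\<close> onto the up-sets of a poset \<open>X\<close> under reverse inclusion turns
  infima into unions, binary joins into intersections and the top into the empty set. So \<open>L\<close> is
  complete, and it inherits every distributive law that unions and intersections satisfy, in
  particular both the finite law and the infinite law \<open>U \<inter> \<Union>\<V> = \<Union>{U \<inter> V | V. V \<in> \<V>}\<close>. Principal
  up-sets are completely union-irreducible, because an up-set that contains \<open>x\<close> contains everything
  above \<open>x\<close>; and every up-set is the union of the principal up-sets of its points. Read back in
  \<open>L\<close>, this is the Decomposition Property.

  Second, the lattice \<open>L\<close> determines a candidate for \<open>X\<close>: its completely meet-irreducible elements
  \<open>M(L)\<close> with the order of \<open>L\<close>. The map \<open>a \<mapsto> {p \<in> M(L). a \<sqsubseteq> p}\<close> into the up-sets of \<open>M(L)\<close> is an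
  order embedding exactly by the Decomposition Property, and condition \<open>(\<MM>)\<close> is what makes it
  surjective: \<open>U\<close> is the image of \<open>\<Sqinter>U\<close>. Since \<open>M(L)\<close> is a subset of \<open>L\<close>, a
  representation over an arbitrary type of points yields one whose points are elements of \<open>L\<close>.

  The link between the two is that dual infinite distributivity implies \<open>(\<MM>)\<close>: if \<open>\<Sqinter>C \<sqsubseteq> q\<close> then
  \<open>q = q \<squnion> \<Sqinter>C = \<Sqinter>{q \<squnion> c | c. c \<in> C}\<close>, and irreducibility of \<open>q\<close> yields \<open>q = q \<squnion> c\<close>,
  that is \<open>c \<sqsubseteq> q\<close>, for some \<open>c\<close>.
\<close>

section \<open>Dual infinite distributivity and condition \<open>(\<MM>)\<close>\<close>

lemma cmi_set_subset_carrier: "cmi_set L \<subseteq> carrier L"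
  by (auto simp: cmi_set_def completely_meet_irreducible_def)

text \<open>Distributing \<open>q \<squnion> \<Sqinter>C\<close> turns the inequality \<open>\<Sqinter>C \<sqsubseteq> q\<close> into an equation that exhibits \<open>q\<close> as an
  infimum, which is the only form to which complete irreducibility applies.\<close>

lemma condition_M_if_dual_infinitely_distributive:
  assumes "complete_lattice L" and did: "dual_infinitely_distributive L"
  shows "condition_M L"
  unfolding condition_M_def
proof (intro ballI allI impI)
  interpret complete_lattice L by fact
  fix q C
  assume q: "q \<in> cmi_set L" and C: "C \<subseteq> cmi_set L" and le: "\<Sqinter>\<^bsub>L\<^esub>C \<sqsubseteq>\<^bsub>L\<^esub> q"
  have qL: "q \<in> carrier L" and CL: "C \<subseteq> carrier L"
    using q C cmi_set_subset_carrier[of L] by blast+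
  have "q = \<Sqinter>\<^bsub>L\<^esub>C \<squnion>\<^bsub>L\<^esub> q"
    using le qL CL by (simp add: le_iff_meet)
  also have "\<dots> = \<Sqinter>\<^bsub>L\<^esub>((\<lambda>c. q \<squnion>\<^bsub>L\<^esub> c) ` C)"
    using did qL CL unfolding dual_infinitely_distributive_def by (simp add: join_comm)
  finally have "q = \<Sqinter>\<^bsub>L\<^esub>((\<lambda>c. q \<squnion>\<^bsub>L\<^esub> c) ` C)" .
  moreover have "(\<lambda>c. q \<squnion>\<^bsub>L\<^esub> c) ` C \<subseteq> carrier L"
    using qL CL by auto
  ultimately obtain c where c: "c \<in> C" and "q = q \<squnion>\<^bsub>L\<^esub> c"
    using q unfolding cmi_set_def completely_meet_irreducible_def by blast
  then have "c \<sqsubseteq>\<^bsub>L\<^esub> q"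
    using qL CL by (metis join_right subsetD)
  with c show "\<exists>p\<in>C. p \<sqsubseteq>\<^bsub>L\<^esub> q" ..
qed

section \<open>The representation by completely meet-irreducible elements\<close>

lemma partial_order_up_set_lattice: "partial_order (up_set_lattice X)"
  by unfold_locales (auto simp: up_set_lattice_def)

definition cmi_poset :: "('a, 'c) gorder_scheme \<Rightarrow> 'a gorder" where
  "cmi_poset L = \<lparr>carrier = cmi_set L, eq = (=), le = le L\<rparr>"

text \<open>If there were no completely meet-irreducible elements, the top, being the infimum of the empty
  set, would be the only element with a decomposition; so the lattice has to be nontrivial.\<close>

lemma poset_cmi_poset:
  assumes "partial_order L" and DP: "decomposition_property L"
    and "\<exists>x\<in>carrier L. \<exists>y\<in>carrier L. x \<noteq> y"
  shows "poset (cmi_poset L)"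
proof -
  interpret partial_order L by fact
  have "partial_order (cmi_poset L)"
    using cmi_set_subset_carrier[of L]
    by unfold_locales (auto simp: cmi_poset_def intro: le_trans)
  moreover have "cmi_set L \<noteq> {}"
  proof
    assume "cmi_set L = {}"
    then have "x = \<Sqinter>\<^bsub>L\<^esub>{}" if "x \<in> carrier L" for x
      using DP that unfolding decomposition_property_def by auto
    with assms(3) show False by metis
  qed
  ultimately show ?thesis
    by (simp add: poset_def cmi_poset_def)
qed

text \<open>The isomorphism sends \<open>a\<close> to the set of irreducibles above it, and its inverse is the infimum.
  Decomposability says that \<open>a\<close> is recovered from this set. Condition \<open>(\<MM>)\<close> says that forming the
  infimum of an up-set \<open>U\<close> of irreducibles creates no new irreducible above it.\<close>

lemma order_isomorphic_up_sets_of_cmi: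
  assumes "complete_lattice L" and DP: "decomposition_property L" and M: "condition_M L"
  shows "order_isomorphic L (up_set_lattice (cmi_poset L))"
proof -
  interpret complete_lattice L by fact
  interpret U: partial_order "up_set_lattice (cmi_poset L)"
    by (rule partial_order_up_set_lattice)
  note cmi_carrier = cmi_set_subset_carrier[of L]
  define f where "f a = {p \<in> cmi_set L. a \<sqsubseteq>\<^bsub>L\<^esub> p}" for a
  have f_closed: "f a \<in> carrier (up_set_lattice (cmi_poset L))" if "a \<in> carrier L" for a
    using that cmi_carrier by (auto simp: f_def up_set_lattice_def up_set_def cmi_poset_def intro: le_trans)
  have f_le: "f b \<subseteq> f a \<longleftrightarrow> a \<sqsubseteq>\<^bsub>L\<^esub> b" if a: "a \<in> carrier L" and b: "b \<in> carrier L" for a b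
  proof
    assume sub: "f b \<subseteq> f a"
    obtain Q where Q: "Q \<subseteq> cmi_set L" "b = \<Sqinter>\<^bsub>L\<^esub>Q"
      using DP b unfolding decomposition_property_def by blast
    then have QL: "Q \<subseteq> carrier L" using cmi_carrier by blast
    have "Q \<subseteq> f b"
      using Q QL inf_lower by (auto simp: f_def)
    with sub have "\<And>p. p \<in> Q \<Longrightarrow> a \<sqsubseteq>\<^bsub>L\<^esub> p"
      by (auto simp: f_def)
    then show "a \<sqsubseteq>\<^bsub>L\<^esub> b"
      unfolding Q(2) using QL a by (intro inf_greatest)
  next
    assume "a \<sqsubseteq>\<^bsub>L\<^esub> b"
    then show "f b \<subseteq> f a"
      using a b cmi_carrier by (auto simp: f_def intro: le_trans)
  qed
  have f_Inf: "f (\<Sqinter>\<^bsub>L\<^esub>U) = U" if "up_set (cmi_poset L) U" for U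
  proof
    have UM: "U \<subseteq> cmi_set L"
      and up: "\<And>x y. x \<in> U \<Longrightarrow> y \<in> cmi_set L \<Longrightarrow> x \<sqsubseteq>\<^bsub>L\<^esub> y \<Longrightarrow> y \<in> U"
      using that by (auto simp: up_set_def cmi_poset_def)
    show "U \<subseteq> f (\<Sqinter>\<^bsub>L\<^esub>U)"
      using UM cmi_carrier inf_lower[of U] by (auto simp: f_def)
    show "f (\<Sqinter>\<^bsub>L\<^esub>U) \<subseteq> U"
    proof
      fix q assume "q \<in> f (\<Sqinter>\<^bsub>L\<^esub>U)"
      then have q: "q \<in> cmi_set L" "\<Sqinter>\<^bsub>L\<^esub>U \<sqsubseteq>\<^bsub>L\<^esub> q"
        by (auto simp: f_def)
      then obtain p where "p \<in> U" "p \<sqsubseteq>\<^bsub>L\<^esub> q"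
        using M UM unfolding condition_M_def by blast
      with up q(1) show "q \<in> U" by blast
    qed
  qed
  have "order_emb L (up_set_lattice (cmi_poset L)) f"
    using f_le weak_partial_order_axioms U.weak_partial_order_axioms
    by (simp add: order_emb_def up_set_lattice_def)
  moreover have "bij_betw f (carrier L) (carrier (up_set_lattice (cmi_poset L)))"
    unfolding bij_betw_def
  proof
    show "inj_on f (carrier L)"
    proof (rule inj_onI)
      fix a b assume "a \<in> carrier L" "b \<in> carrier L" "f a = f b"
      then show "a = b"
        using f_le[of a b] f_le[of b a] by (simp add: le_antisym)
    qed
    have "U \<in> f ` carrier L" if "U \<in> carrier (up_set_lattice (cmi_poset L))" for U
    proof -
      have U: "up_set (cmi_poset L) U"
        using that by (simp add: up_set_lattice_def)
      then have "U \<subseteq> carrier L"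
        using cmi_carrier by (auto simp: up_set_def cmi_poset_def)
      then show ?thesis
        using f_Inf[OF U] by (metis image_eqI inf_closed)
    qed
    then show "f ` carrier L = carrier (up_set_lattice (cmi_poset L))"
      using f_closed by blast
  qed
  ultimately show ?thesis
    unfolding order_isomorphic_def by blast
qed

section \<open>Lattices isomorphic to a lattice of up-sets\<close>

locale up_set_representation = partial_order L
  for L :: "('a, 'c) gorder_scheme" (structure) +
  fixes X :: "('b, 'd) gorder_scheme" and f :: "'a \<Rightarrow> 'b set"
  assumes poset: "poset X"
    and f_bij: "bij_betw f (carrier L) {U. up_set X U}"
    and f_le_iff: "\<lbrakk>a \<in> carrier L; b \<in> carrier L\<rbrakk> \<Longrightarrow> f b \<subseteq> f a \<longleftrightarrow> a \<sqsubseteq> b"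
begin

lemma f_eq_iff: "\<lbrakk>a \<in> carrier L; b \<in> carrier L\<rbrakk> \<Longrightarrow> f a = f b \<longleftrightarrow> a = b"
  using f_bij by (auto simp: bij_betw_def inj_on_def)

lemma up_set_f: "a \<in> carrier L \<Longrightarrow> up_set X (f a)"
  using f_bij by (auto simp: bij_betw_def)

lemma ex_preimage:
  assumes "up_set X U"
  obtains a where "a \<in> carrier L" "f a = U"
proof -
  have "U \<in> f ` carrier L"
    using assms f_bij by (simp add: bij_betw_def)
  then show ?thesis using that by blast
qed

lemma is_glb_if_Union:
  assumes "S \<subseteq> carrier L" "a \<in> carrier L" "f a = \<Union>(f ` S)"
  shows "is_glb L a S"
proof (rule greatest_LowerI)
  show "a \<sqsubseteq> x" if "x \<in> S" for x
    using assms that f_le_iff[of a x] by auto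
  show "y \<sqsubseteq> a" if y: "y \<in> Lower L S" for y
  proof -
    have yL: "y \<in> carrier L" using y by (simp add: Lower_def)
    have "f x \<subseteq> f y" if "x \<in> S" for x
      using that y assms(1) f_le_iff[OF yL] by (metis Lower_memD subsetD)
    then show ?thesis
      using assms yL f_le_iff[of y a] by auto
  qed
qed (use assms in auto)

lemma is_lub_if_Inter:
  assumes "S \<subseteq> carrier L" "a \<in> carrier L" "f a = carrier X \<inter> \<Inter>(f ` S)"
  shows "is_lub L a S"
proof (rule least_UpperI)
  show "x \<sqsubseteq> a" if "x \<in> S" for x
    using assms that f_le_iff[of x a] by auto
  show "a \<sqsubseteq> y" if y: "y \<in> Upper L S" for y
  proof -
    have yL: "y \<in> carrier L" using y by (simp add: Upper_def)
    have "f y \<subseteq> f x" if "x \<in> S" for x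
      using that y assms(1) f_le_iff[OF _ yL] by (metis Upper_memD subsetD)
    moreover have "f y \<subseteq> carrier X"
      using up_set_f[OF yL] by (simp add: up_set_def)
    ultimately show ?thesis
      using assms f_le_iff[OF assms(2) yL] by auto
  qed
qed (use assms in auto)

lemma ex_preimage_Union:
  assumes "S \<subseteq> carrier L"
  obtains a where "a \<in> carrier L" "f a = \<Union>(f ` S)"
proof -
  have "up_set X (\<Union>(f ` S))"
    using assms up_set_f unfolding up_set_def by blast
  then show ?thesis using that by (rule ex_preimage)
qed

text \<open>The supremum of the empty set is the bottom, which corresponds to the whole of \<open>X\<close>; hence the
  intersection is taken inside \<open>carrier X\<close>.\<close>

lemma ex_preimage_Inter:
  assumes "S \<subseteq> carrier L"
  obtains a where "a \<in> carrier L" "f a = carrier X \<inter> \<Inter>(f ` S)"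
proof -
  have "y \<in> f s" if "s \<in> S" "x \<in> f s" "y \<in> carrier X" "x \<sqsubseteq>\<^bsub>X\<^esub> y" for s x y
    using that assms up_set_f[of s] by (auto simp: up_set_def)
  then have "up_set X (carrier X \<inter> \<Inter>(f ` S))"
    unfolding up_set_def by blast
  then show ?thesis using that by (rule ex_preimage)
qed

lemma complete_lattice: "complete_lattice L"
proof (rule complete_latticeI)
  fix S assume S: "S \<subseteq> carrier L"
  show "\<exists>s. is_lub L s S"
    by (rule ex_preimage_Inter[OF S]) (intro exI is_lub_if_Inter[OF S])
  show "\<exists>i. is_glb L i S"
    by (rule ex_preimage_Union[OF S]) (intro exI is_glb_if_Union[OF S])
qed

sublocale complete_lattice L
  by (rule complete_lattice)

lemma f_Inf: "S \<subseteq> carrier L \<Longrightarrow> f (\<Sqinter>S) = \<Union>(f ` S)"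
proof -
  assume S: "S \<subseteq> carrier L"
  then obtain a where a: "a \<in> carrier L" "f a = \<Union>(f ` S)"
    by (rule ex_preimage_Union)
  then have "a = \<Sqinter>S"
    by (intro greatest_unique[OF is_glb_if_Union[OF S] inf_glb[OF S]])
  with a show ?thesis by simp
qed

lemma f_meet: "\<lbrakk>a \<in> carrier L; b \<in> carrier L\<rbrakk> \<Longrightarrow> f (a \<sqinter> b) = f a \<union> f b"
  using f_Inf[of "{a, b}"] by (simp add: meet_def)

lemma f_join:
  assumes "a \<in> carrier L" "b \<in> carrier L"
  shows "f (a \<squnion> b) = f a \<inter> f b"
proof -
  have S: "{a, b} \<subseteq> carrier L" using assms by simp
  then obtain c where c: "c \<in> carrier L" "f c = carrier X \<inter> \<Inter>(f ` {a, b})"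
    by (rule ex_preimage_Inter)
  then have "c = a \<squnion> b"
    unfolding join_def by (intro least_unique[OF is_lub_if_Inter[OF S] sup_lub[OF S]])
  moreover have "f a \<subseteq> carrier X"
    using up_set_f[OF assms(1)] by (simp add: up_set_def)
  ultimately show ?thesis using c by auto
qed

lemma f_top: "f \<top> = {}"
  using f_Inf[of "{}"] weak_inf_empty by (simp add: eq_is_equal)

lemma distributive: "distributive L"
  unfolding distributive_def
proof (intro ballI)
  fix x y z assume "x \<in> carrier L" "y \<in> carrier L" "z \<in> carrier L"
  moreover from this have "f (x \<sqinter> (y \<squnion> z)) = f ((x \<sqinter> y) \<squnion> (x \<sqinter> z))"
    by (simp add: f_meet f_join Un_Int_distrib)
  ultimately show "x \<sqinter> (y \<squnion> z) = (x \<sqinter> y) \<squnion> (x \<sqinter> z)"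
    by (simp add: f_eq_iff)
qed

lemma dual_infinitely_distributive: "dual_infinitely_distributive L"
  unfolding dual_infinitely_distributive_def
proof (intro ballI allI impI)
  fix x S assume x: "x \<in> carrier L" and S: "S \<subseteq> carrier L"
  then have xS: "(\<lambda>s. x \<squnion> s) ` S \<subseteq> carrier L" by auto
  have "f (x \<squnion> \<Sqinter>S) = (\<Union>s\<in>S. f x \<inter> f s)"
    using x S by (simp add: f_join f_Inf)
  also have "\<dots> = (\<Union>s\<in>S. f (x \<squnion> s))"
    using x S by (intro SUP_cong) (auto simp: f_join)
  also have "\<dots> = f (\<Sqinter>((\<lambda>s. x \<squnion> s) ` S))"
    using f_Inf[OF xS] by (simp add: image_image)
  finally show "x \<squnion> \<Sqinter>S = \<Sqinter>((\<lambda>s. x \<squnion> s) ` S)"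
    using x S xS by (simp add: f_eq_iff)
qed

text \<open>If the principal up-set of \<open>x\<close> is a union of up-sets, one of them contains \<open>x\<close>, hence contains
  the principal up-set, and equality follows.\<close>

lemma principal_up_set_cmi:
  assumes x: "x \<in> carrier X" and p: "p \<in> carrier L" "f p = {y \<in> carrier X. x \<sqsubseteq>\<^bsub>X\<^esub> y}"
  shows "p \<in> cmi_set L"
proof -
  interpret X: partial_order X using poset by (simp add: poset_def)
  have xp: "x \<in> f p" using x p by simp
  have "\<exists>s\<in>S. p = s" if S: "S \<subseteq> carrier L" and pS: "p = \<Sqinter>S" for S
  proof -
    have fp: "f p = \<Union>(f ` S)" using f_Inf[OF S] pS by simp
    with xp obtain s where s: "s \<in> S" "x \<in> f s" by auto
    then have "f p \<subseteq> f s"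
      using p(2) up_set_f[of s] S by (auto simp: up_set_def)
    with fp s have "f p = f s" by auto
    then show ?thesis using s S p(1) f_eq_iff by blast
  qed
  moreover have "p \<noteq> \<top>" using xp f_top by auto
  ultimately show ?thesis
    using p(1) by (simp add: cmi_set_def completely_meet_irreducible_def)
qed

lemma decomposition_property: "decomposition_property L"
  unfolding decomposition_property_def
proof
  interpret X: partial_order X using poset by (simp add: poset_def)
  fix a assume a: "a \<in> carrier L"
  \<comment> \<open>The largest candidate; the members that correspond to principal up-sets already cover \<open>f a\<close>.\<close>
  define Q where "Q = {p \<in> cmi_set L. a \<sqsubseteq> p}"
  have QL: "Q \<subseteq> carrier L"
    using cmi_set_subset_carrier[of L] by (auto simp: Q_def)
  have "f a \<subseteq> \<Union>(f ` Q)"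
  proof
    fix x assume xa: "x \<in> f a"
    then have x: "x \<in> carrier X"
      using up_set_f[OF a] by (auto simp: up_set_def)
    have "up_set X {y \<in> carrier X. x \<sqsubseteq>\<^bsub>X\<^esub> y}"
      using x by (auto simp: up_set_def intro: X.le_trans)
    then obtain p where p: "p \<in> carrier L" "f p = {y \<in> carrier X. x \<sqsubseteq>\<^bsub>X\<^esub> y}"
      by (rule ex_preimage)
    have "f p \<subseteq> f a"
      using p(2) xa up_set_f[OF a] by (auto simp: up_set_def)
    then have "p \<in> Q"
      using principal_up_set_cmi[OF x p] f_le_iff[OF a p(1)] by (simp add: Q_def)
    moreover have "x \<in> f p" using x p by simp
    ultimately show "x \<in> \<Union>(f ` Q)" by blast
  qed
  moreover have "\<Union>(f ` Q) \<subseteq> f a"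
    using a QL f_le_iff by (auto simp: Q_def)
  ultimately have "f a = f (\<Sqinter>Q)"
    using f_Inf[OF QL] by simp
  then have "a = \<Sqinter>Q"
    using a QL by (simp add: f_eq_iff)
  moreover have "Q \<subseteq> cmi_set L" by (simp add: Q_def)
  ultimately show "\<exists>Q\<subseteq>cmi_set L. a = \<Sqinter>Q" by blast
qed

end

lemma up_set_representationI:
  assumes "partial_order L" "poset X" "order_isomorphic L (up_set_lattice X)"
  shows "\<exists>f. up_set_representation L X f"
  using assms unfolding order_isomorphic_def up_set_representation_def
    up_set_representation_axioms_def order_emb_def
  by (auto simp: up_set_lattice_def)

lemma lattice_properties_if_order_isomorphic_up_sets:
  assumes "partial_order L" "poset X" "order_isomorphic L (up_set_lattice X)"
  shows "complete_lattice L" "distributive L" "dual_infinitely_distributive L"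
    "decomposition_property L"
proof -
  obtain f where "up_set_representation L X f"
    using up_set_representationI[OF assms] by blast
  then interpret up_set_representation L X f .
  show "complete_lattice L" "distributive L" "dual_infinitely_distributive L"
    "decomposition_property L"
    by (fact complete_lattice distributive dual_infinitely_distributive decomposition_property)+
qed

section \<open>The equivalence\<close>

theorem theorem3p1:
  fixes L :: "'a gorder"
  assumes "lattice L"
    and "\<exists>x\<in>carrier L. \<exists>y\<in>carrier L. x \<noteq> y"
  shows
    "((\<exists>X :: 'a gorder. poset X \<and> order_isomorphic L (up_set_lattice X)) \<longleftrightarrow>
        (complete_lattice L \<and> distributive L \<and> decomposition_property L \<and> condition_M L))
     \<and> ((complete_lattice L \<and> distributive L \<and> decomposition_property L \<and> condition_M L) \<longleftrightarrow>
        (complete_lattice L \<and> dual_infinitely_distributive L \<and> decomposition_property L))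
     \<and> ((\<exists>X :: 'b gorder. poset X \<and> order_isomorphic L (up_set_lattice X)) \<longrightarrow>
        (\<exists>X :: 'a gorder. poset X \<and> order_isomorphic L (up_set_lattice X)))"
proof -
  interpret lattice L by fact
  let ?F = "\<exists>X :: 'a gorder. poset X \<and> order_isomorphic L (up_set_lattice X)"
  note represented = lattice_properties_if_order_isomorphic_up_sets[OF partial_order_axioms]
  have represent: ?F if "complete_lattice L" "decomposition_property L" "condition_M L"
    using poset_cmi_poset[OF partial_order_axioms that(2) assms(2)]
      order_isomorphic_up_sets_of_cmi[OF that] by blast
  note M = condition_M_if_dual_infinitely_distributive[of L]
  \<comment> \<open>A representation over any type of points yields both distributive laws and \<open>DP\<close>, hence also
    \<open>(\<MM>)\<close>; conversely \<open>DP\<close> and \<open>(\<MM>)\<close>, available under either algebraic condition, represent \<open>L\<close>.\<close>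
  show ?thesis
  proof (rule conjI[OF iffI conjI[OF iffI impI]])
    assume ?F
    then obtain X :: "'a gorder" where X: "poset X" "order_isomorphic L (up_set_lattice X)"
      by blast
    note represented[OF X]
    with M show "complete_lattice L \<and> distributive L \<and> decomposition_property L \<and> condition_M L"
      by simp
  next
    assume "complete_lattice L \<and> distributive L \<and> decomposition_property L \<and> condition_M L"
    then show ?F using represent by simp
  next
    assume "complete_lattice L \<and> distributive L \<and> decomposition_property L \<and> condition_M L"
    then obtain X :: "'a gorder" where X: "poset X" "order_isomorphic L (up_set_lattice X)"
      using represent by blast
    note represented[OF X]
    then show "complete_lattice L \<and> dual_infinitely_distributive L \<and> decomposition_property L"
      by simp
  next
    assume b3: "complete_lattice L \<and> dual_infinitely_distributive L \<and> decomposition_property L"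
    with M have "condition_M L" by simp
    with b3 obtain X :: "'a gorder" where X: "poset X" "order_isomorphic L (up_set_lattice X)"
      using represent by blast
    note represented[OF X]
    with \<open>condition_M L\<close>
    show "complete_lattice L \<and> distributive L \<and> decomposition_property L \<and> condition_M L"
      by simp
  next
    assume "\<exists>X :: 'b gorder. poset X \<and> order_isomorphic L (up_set_lattice X)"
    then obtain X :: "'b gorder" where X: "poset X" "order_isomorphic L (up_set_lattice X)"
      by blast
    note represented[OF X]
    with M represent show ?F by simp
  qed
qed

end
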